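(* Let $R$ be a commutative zero-sum-free semiring, $X$ and $Y$ simplicial sets where $X$ has finitely many non-degenerate simplices, $x\in X_n$ with $n\ge1$, $0\le i\le n-1$, and let $\pi=\pi^{s^i,x}:X\to\bar X$ be the corresponding collapsing map. For a simplicial distribution $p:\bar X\to D_R(Y)$, with $\pi^*(p)=p\circ\pi$, the following hold: 1. $p$ is contextual if and only if $\pi^*(p)$ is contextual. 2. $p$ is strongly contextual if and only if $\pi^*(p)$ is strongly contextual. 3. If $R$ is also integral, then $p$ is a vertex (of $\mathrm{sSet}(\bar X,D_R(Y))$) if and only if $\pi^*(p)$ is a vertex (of $\mathrm{sSet}(X,D_R(Y))$). 4. $p$ is a deterministic distribution if and only if $\pi^*(p)$ is a deterministic distribution. 5. If $R$ is also integral, then $p$ is a contextual vertex if and only if $\pi^*(p)$ is a contextual vertex.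
   Context: Semirings are assumed to satisfy $0\neq1$. $R$ is zero-sum-free if $a+b=0$ implies $a=b=0$, and integral if $ab=0$ implies $a=0$ or $b=0$. For a set $S$, $D_R(S)$ is the set of finitely supported functions $p:S\to R$ with $\sum_s p(s)=1$, functorial by pushforward; $\delta^s$ is the delta distribution. For a simplicial set $Y$, $D_R(Y)$ is obtained degreewise. A simplicial distribution on $(X,Y)$ is a simplicial set map $p:X\to D_R(Y)$; $\mathrm{sSet}(X,Y)$ is the set of simplicial set maps. Collapsing map: for $x\in X_n$ viewed as a map $x:\Delta[n]\to X$ and $s^i:\Delta[n]\to\Delta[n-1]$ the map induced by the degeneracy $s^i:[n]\to[n-1]$, $\bar X=X^{s^i,x}$ is the pushout of $\Delta[n-1]\xleftarrow{s^i}\Delta[n]\xrightarrow{x}X$ and $\pi^{s^i,x}:X\to\bar X$ is the canonical map. Deterministic: $p=\delta^\varphi$ for some $\varphi\in\mathrm{sSet}(X,Y)$, where $\delta^\varphi$ sends a simplex $z$ to $\delta^{\varphi(z)}$. Non-contextual: there is $d\in D_R(\mathrm{sSet}(X,Y))$ with $p_n(z)(y)=\sum_{\varphi:\varphi_n(z)=y}d(\varphi)$ for all $n$, $z\in X_n$, $y\in Y_n$; otherwise $p$ is contextual. Strongly contextual: there is no $\varphi\in\mathrm{sSet}(X,Y)$ with $p_n(z)(\varphi_n(z))\ne0$ for all $n$ and $z\in X_n$. Vertex: $p$ has a unique preimage under $\nu:D_R(\mathrm{sSet}(X,D_R(Y)))\to\mathrm{sSet}(X,D_R(Y))$, $\nu(Q)_n(z)=\sum_q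 Q(q)\,q_n(z)$. *)

theory Defs
  imports "HOL-Library.FuncSet"
begin

section \<open>Simplicial sets\<close>

text \<open>
  The morphisms \<open>[m] \<rightarrow> [n]\<close> of the simplex category are the monotone maps
  \<open>{0..m} \<rightarrow> {0..n}\<close>, made extensional so that each one is represented by exactly one function.
\<close>

definition delta_hom :: "nat \<Rightarrow> nat \<Rightarrow> (nat \<Rightarrow> nat) set" where
  "delta_hom m n = {\<theta> \<in> {0..m} \<rightarrow>\<^sub>E {0..n}. mono_on {0..m} \<theta>}"

text \<open>
  A simplicial set is a contravariant functor on the simplex category: \<open>simp X n\<close> is the set of
  \<open>n\<close>-simplices and, for \<open>\<theta> : [m] \<rightarrow> [n]\<close>, \<open>act X m n \<theta>\<close> is the induced map \<open>X\<^sub>n \<rightarrow> X\<^sub>m\<close>.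
  Its values outside \<open>X\<^sub>n\<close> are irrelevant.
\<close>

record 'a sset =
  simp :: "nat \<Rightarrow> 'a set"
  act :: "nat \<Rightarrow> nat \<Rightarrow> (nat \<Rightarrow> nat) \<Rightarrow> 'a \<Rightarrow> 'a"

locale simplicial_set =
  fixes X :: "'a sset"
  assumes act_closed:
      "\<And>m n \<theta> z. \<theta> \<in> delta_hom m n \<Longrightarrow> z \<in> simp X n \<Longrightarrow> act X m n \<theta> z \<in> simp X m"
    and act_id:
      "\<And>n z. z \<in> simp X n \<Longrightarrow> act X n n (\<lambda>k\<in>{0..n}. k) z = z"
    and act_comp:
      "\<And>k m n \<eta> \<theta> z. \<eta> \<in> delta_hom k m \<Longrightarrow> \<theta> \<in> delta_hom m n \<Longrightarrow> z \<in> simp X n \<Longrightarrow>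
         act X k n (compose {0..k} \<theta> \<eta>) z = act X k m \<eta> (act X m n \<theta> z)"

text \<open>The set of simplicial maps; extensionality in each degree makes the representation unique.\<close>

definition sMap :: "'a sset \<Rightarrow> 'b sset \<Rightarrow> (nat \<Rightarrow> 'a \<Rightarrow> 'b) set" where
  "sMap X Y = {f. (\<forall>n. f n \<in> simp X n \<rightarrow>\<^sub>E simp Y n) \<and>
     (\<forall>m n. \<forall>\<theta>\<in>delta_hom m n. \<forall>z\<in>simp X n. f m (act X m n \<theta> z) = act Y m n \<theta> (f n z))}"

definition sMap_comp :: "'a sset \<Rightarrow> (nat \<Rightarrow> 'b \<Rightarrow> 'c) \<Rightarrow> (nat \<Rightarrow> 'a \<Rightarrow> 'b) \<Rightarrow> (nat \<Rightarrow> 'a \<Rightarrow> 'c)" where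
  "sMap_comp X g f = (\<lambda>n. compose (simp X n) (g n) (f n))"

text \<open>The codegeneracy \<open>s\<^sup>i : [n] \<rightarrow> [n-1]\<close>, which hits \<open>i\<close> twice; meaningful for \<open>i < n\<close>.\<close>

definition codegen :: "nat \<Rightarrow> nat \<Rightarrow> (nat \<Rightarrow> nat)" where
  "codegen n i = (\<lambda>k\<in>{0..n}. if k \<le> i then k else k - 1)"

definition degenerate :: "'a sset \<Rightarrow> nat \<Rightarrow> 'a \<Rightarrow> bool" where
  "degenerate X n z \<longleftrightarrow> (\<exists>j y. j < n \<and> y \<in> simp X (n - 1) \<and> z = act X n (n - 1) (codegen n j) y)"

definition nondegenerate_simplices :: "'a sset \<Rightarrow> (nat \<times> 'a) set" where
  "nondegenerate_simplices X = {(n, z). z \<in> simp X n \<and> \<not> degenerate X n z}"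

definition std_simplex :: "nat \<Rightarrow> (nat \<Rightarrow> nat) sset" where
  "std_simplex n = \<lparr>simp = (\<lambda>m. delta_hom m n), act = (\<lambda>k m \<eta> \<theta>. compose {0..k} \<theta> \<eta>)\<rparr>"

text \<open>The map \<open>\<Delta>[m] \<rightarrow> \<Delta>[n]\<close> induced by \<open>\<alpha> : [m] \<rightarrow> [n]\<close>.\<close>

definition std_simplex_map :: "nat \<Rightarrow> (nat \<Rightarrow> nat) \<Rightarrow> (nat \<Rightarrow> (nat \<Rightarrow> nat) \<Rightarrow> (nat \<Rightarrow> nat))" where
  "std_simplex_map m \<alpha> = (\<lambda>k. \<lambda>\<theta>\<in>delta_hom k m. compose {0..k} \<alpha> \<theta>)"

text \<open>An \<open>n\<close>-simplex \<open>x\<close> viewed as a map \<open>\<Delta>[n] \<rightarrow> X\<close>.\<close>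

definition yoneda :: "'a sset \<Rightarrow> nat \<Rightarrow> 'a \<Rightarrow> (nat \<Rightarrow> (nat \<Rightarrow> nat) \<Rightarrow> 'a)" where
  "yoneda X n x = (\<lambda>m. \<lambda>\<theta>\<in>delta_hom m n. act X m n \<theta> x)"

section \<open>Pushouts and the collapsing map\<close>

text \<open>
  The pushout of \<open>B \<leftarrow> A \<rightarrow> C\<close> (along \<open>f\<close> and \<open>g\<close>) is, in each degree, the disjoint union of \<open>B\<close>
  and \<open>C\<close> modulo the equivalence relation generated by \<open>f a \<sim> g a\<close>.
\<close>

definition pushout_rel ::
  "'a sset \<Rightarrow> (nat \<Rightarrow> 'a \<Rightarrow> 'b) \<Rightarrow> (nat \<Rightarrow> 'a \<Rightarrow> 'c) \<Rightarrow> nat \<Rightarrow> (('b + 'c) \<times> ('b + 'c)) set" where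
  "pushout_rel A f g n =
     (let r = {(Inl (f n a), Inr (g n a)) | a. a \<in> simp A n} in (r \<union> r\<inverse>)\<^sup>*)"

text \<open>
  A simplex of the pushout is an equivalence class; \<open>\<theta>\<close> sends it to the class of the images of
  its representatives.
\<close>

definition pushout ::
  "'a sset \<Rightarrow> 'b sset \<Rightarrow> 'c sset \<Rightarrow> (nat \<Rightarrow> 'a \<Rightarrow> 'b) \<Rightarrow> (nat \<Rightarrow> 'a \<Rightarrow> 'c) \<Rightarrow> ('b + 'c) set sset" where
  "pushout A B C f g =
     \<lparr>simp = (\<lambda>n. (simp B n <+> simp C n) // pushout_rel A f g n),
      act = (\<lambda>m n \<theta> c. pushout_rel A f g m `` (map_sum (act B m n \<theta>) (act C m n \<theta>) ` c))\<rparr>"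

definition pushout_inl ::
  "'a sset \<Rightarrow> 'b sset \<Rightarrow> (nat \<Rightarrow> 'a \<Rightarrow> 'b) \<Rightarrow> (nat \<Rightarrow> 'a \<Rightarrow> 'c) \<Rightarrow> (nat \<Rightarrow> 'b \<Rightarrow> ('b + 'c) set)" where
  "pushout_inl A B f g = (\<lambda>n. \<lambda>z\<in>simp B n. pushout_rel A f g n `` {Inl z})"

definition pushout_inr ::
  "'a sset \<Rightarrow> 'c sset \<Rightarrow> (nat \<Rightarrow> 'a \<Rightarrow> 'b) \<Rightarrow> (nat \<Rightarrow> 'a \<Rightarrow> 'c) \<Rightarrow> (nat \<Rightarrow> 'c \<Rightarrow> ('b + 'c) set)" where
  "pushout_inr A C f g = (\<lambda>n. \<lambda>z\<in>simp C n. pushout_rel A f g n `` {Inr z})"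

definition collapse :: "'a sset \<Rightarrow> nat \<Rightarrow> nat \<Rightarrow> 'a \<Rightarrow> ((nat \<Rightarrow> nat) + 'a) set sset" where
  "collapse X n i x =
     pushout (std_simplex n) (std_simplex (n - 1)) X
       (std_simplex_map n (codegen n i)) (yoneda X n x)"

definition collapsing_map ::
  "'a sset \<Rightarrow> nat \<Rightarrow> nat \<Rightarrow> 'a \<Rightarrow> (nat \<Rightarrow> 'a \<Rightarrow> ((nat \<Rightarrow> nat) + 'a) set)" where
  "collapsing_map X n i x =
     pushout_inr (std_simplex n) X (std_simplex_map n (codegen n i)) (yoneda X n x)"

section \<open>Distributions with values in a semiring\<close>

text \<open>\<open>comm_semiring_1\<close> includes the requirement that 0 and 1 are distinct.\<close>

definition zero_sum_free :: "'r::comm_semiring_1 itself \<Rightarrow> bool" where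
  "zero_sum_free _ \<longleftrightarrow> (\<forall>a b :: 'r. a + b = 0 \<longrightarrow> a = 0 \<and> b = 0)"

definition integral_semiring :: "'r::comm_semiring_1 itself \<Rightarrow> bool" where
  "integral_semiring _ \<longleftrightarrow> (\<forall>a b :: 'r. a * b = 0 \<longrightarrow> a = 0 \<or> b = 0)"

definition supp :: "('s \<Rightarrow> 'r::zero) \<Rightarrow> 's set" where
  "supp d = {s. d s \<noteq> 0}"

text \<open>A distribution on \<open>S\<close> is represented by its extension by zero to the whole type.\<close>

definition dist :: "'s set \<Rightarrow> ('s \<Rightarrow> 'r::comm_semiring_1) set" where
  "dist S = {d. finite (supp d) \<and> supp d \<subseteq> S \<and> (\<Sum>s\<in>supp d. d s) = 1}"

definition push_dist :: "('s \<Rightarrow> 't) \<Rightarrow> ('s \<Rightarrow> 'r::comm_semiring_1) \<Rightarrow> ('t \<Rightarrow> 'r)" where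
  "push_dist f d = (\<lambda>t. \<Sum>s\<in>{s \<in> supp d. f s = t}. d s)"

definition delta_dist :: "'s \<Rightarrow> ('s \<Rightarrow> 'r::comm_semiring_1)" where
  "delta_dist s = (\<lambda>t. if t = s then 1 else 0)"

definition dist_sset :: "'b sset \<Rightarrow> ('b \<Rightarrow> 'r::comm_semiring_1) sset" where
  "dist_sset Y = \<lparr>simp = (\<lambda>n. dist (simp Y n)), act = (\<lambda>m n \<theta>. push_dist (act Y m n \<theta>))\<rparr>"

section \<open>Simplicial distributions\<close>

abbreviation simplicial_distributions ::
  "'a sset \<Rightarrow> 'b sset \<Rightarrow> (nat \<Rightarrow> 'a \<Rightarrow> ('b \<Rightarrow> 'r::comm_semiring_1)) set" where
  "simplicial_distributions X Y \<equiv> sMap X (dist_sset Y)"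

definition delta_map ::
  "'a sset \<Rightarrow> (nat \<Rightarrow> 'a \<Rightarrow> 'b) \<Rightarrow> (nat \<Rightarrow> 'a \<Rightarrow> ('b \<Rightarrow> 'r::comm_semiring_1))" where
  "delta_map X \<phi> = (\<lambda>n. \<lambda>z\<in>simp X n. delta_dist (\<phi> n z))"

definition deterministic ::
  "'a sset \<Rightarrow> 'b sset \<Rightarrow> (nat \<Rightarrow> 'a \<Rightarrow> ('b \<Rightarrow> 'r::comm_semiring_1)) \<Rightarrow> bool" where
  "deterministic X Y p \<longleftrightarrow> (\<exists>\<phi>\<in>sMap X Y. p = delta_map X \<phi>)"

definition noncontextual ::
  "'a sset \<Rightarrow> 'b sset \<Rightarrow> (nat \<Rightarrow> 'a \<Rightarrow> ('b \<Rightarrow> 'r::comm_semiring_1)) \<Rightarrow> bool" where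
  "noncontextual X Y p \<longleftrightarrow>
     (\<exists>d\<in>dist (sMap X Y). \<forall>n. \<forall>z\<in>simp X n. \<forall>y\<in>simp Y n.
        p n z y = (\<Sum>\<phi>\<in>{\<phi> \<in> supp d. \<phi> n z = y}. d \<phi>))"

abbreviation contextual ::
  "'a sset \<Rightarrow> 'b sset \<Rightarrow> (nat \<Rightarrow> 'a \<Rightarrow> ('b \<Rightarrow> 'r::comm_semiring_1)) \<Rightarrow> bool" where
  "contextual X Y p \<equiv> \<not> noncontextual X Y p"

definition strongly_contextual ::
  "'a sset \<Rightarrow> 'b sset \<Rightarrow> (nat \<Rightarrow> 'a \<Rightarrow> ('b \<Rightarrow> 'r::comm_semiring_1)) \<Rightarrow> bool" where
  "strongly_contextual X Y p \<longleftrightarrow>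
     \<not> (\<exists>\<phi>\<in>sMap X Y. \<forall>n. \<forall>z\<in>simp X n. p n z (\<phi> n z) \<noteq> 0)"

text \<open>The map \<open>\<nu>\<close> evaluating a formal convex combination of simplicial distributions.\<close>

definition mixture ::
  "'a sset \<Rightarrow> ((nat \<Rightarrow> 'a \<Rightarrow> ('b \<Rightarrow> 'r)) \<Rightarrow> 'r)
     \<Rightarrow> (nat \<Rightarrow> 'a \<Rightarrow> ('b \<Rightarrow> 'r::comm_semiring_1))" where
  "mixture X Q = (\<lambda>n. \<lambda>z\<in>simp X n. \<lambda>y. \<Sum>q\<in>supp Q. Q q * q n z y)"

definition vertex ::
  "'a sset \<Rightarrow> 'b sset \<Rightarrow> (nat \<Rightarrow> 'a \<Rightarrow> ('b \<Rightarrow> 'r::comm_semiring_1)) \<Rightarrow> bool" where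
  "vertex X Y p \<longleftrightarrow> (\<exists>!Q. Q \<in> dist (simplicial_distributions X Y) \<and> mixture X Q = p)"

definition pullback_dist ::
  "'a sset \<Rightarrow> nat \<Rightarrow> nat \<Rightarrow> 'a \<Rightarrow> (nat \<Rightarrow> ((nat \<Rightarrow> nat) + 'a) set \<Rightarrow> ('b \<Rightarrow> 'r))
     \<Rightarrow> (nat \<Rightarrow> 'a \<Rightarrow> ('b \<Rightarrow> 'r::comm_semiring_1))" where
  "pullback_dist X n i x p = sMap_comp X p (collapsing_map X n i x)"

section \<open>The constructions are well defined\<close>

text \<open>
  Standard simplices, distributions and pushouts form simplicial sets, \<open>pushout\<close> has the universal
  property of a pushout, and the collapsing map is a simplicial map.
\<close>

lemma delta_hom_id: "(\<lambda>k\<in>{0..n}. k) \<in> delta_hom n n"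
  by (auto simp: delta_hom_def mono_on_def)

lemma delta_hom_comp:
  "\<eta> \<in> delta_hom k m \<Longrightarrow> \<theta> \<in> delta_hom m n \<Longrightarrow> compose {0..k} \<theta> \<eta> \<in> delta_hom k n"
  unfolding delta_hom_def mono_on_def compose_def
  by (auto simp: PiE_iff)

lemma codegen_hom: "i < n \<Longrightarrow> codegen n i \<in> delta_hom n (n - 1)"
  unfolding codegen_def delta_hom_def mono_on_def by auto

lemma delta_hom_le: "\<theta> \<in> delta_hom m n \<Longrightarrow> k \<le> m \<Longrightarrow> \<theta> k \<le> n"
  by (auto simp: delta_hom_def PiE_iff)

lemma simplicial_set_std_simplex: "simplicial_set (std_simplex n)"
proof
  fix m k \<theta> z assume "\<theta> \<in> delta_hom m k" "z \<in> simp (std_simplex n) k"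
  then show "act (std_simplex n) m k \<theta> z \<in> simp (std_simplex n) m"
    by (simp add: std_simplex_def delta_hom_comp)
next
  fix m z assume "z \<in> simp (std_simplex n) m"
  then have "z \<in> {0..m} \<rightarrow>\<^sub>E {0..n}" by (simp add: std_simplex_def delta_hom_def)
  then show "act (std_simplex n) m m (\<lambda>k\<in>{0..m}. k) z = z"
    by (auto simp: std_simplex_def compose_def fun_eq_iff PiE_iff extensional_def)
next
  fix k m l \<eta> \<theta> z assume "\<eta> \<in> delta_hom k m"
  then show "act (std_simplex n) k l (compose {0..k} \<theta> \<eta>) z
     = act (std_simplex n) k m \<eta> (act (std_simplex n) m l \<theta> z)"
    using delta_hom_le[of \<eta> k m] by (auto simp: std_simplex_def compose_def fun_eq_iff)
qed

lemma std_simplex_map_sMap: "\<alpha> \<in> delta_hom m n \<Longrightarrow> std_simplex_map m \<alpha> \<in> sMap (std_simplex m) (std_simplex n)"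
  using delta_hom_le 
  apply (auto simp: sMap_def std_simplex_map_def std_simplex_def delta_hom_comp)
  apply (fastforce simp: compose_def fun_eq_iff)
  done

lemma yoneda_sMap: "simplicial_set X \<Longrightarrow> x \<in> simp X n \<Longrightarrow> yoneda X n x \<in> sMap (std_simplex n) X"
  by (auto simp: sMap_def yoneda_def std_simplex_def delta_hom_comp simplicial_set.act_closed
    simplicial_set.act_comp)

lemma supp_push: "supp (push_dist f d) \<subseteq> f ` supp d"
proof
  fix t assume "t \<in> supp (push_dist f d)"
  then have "(\<Sum>s\<in>{s \<in> supp d. f s = t}. d s) \<noteq> 0" by (simp add: supp_def push_dist_def)
  then obtain s where "s \<in> {s \<in> supp d. f s = t}" by (meson sum.not_neutral_contains_not_neutral)
  then show "t \<in> f ` supp d" by blast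
qed

lemma push_dist_in:
  assumes "d \<in> dist S" "\<And>s. s \<in> S \<Longrightarrow> f s \<in> T" shows "push_dist f d \<in> dist T"
proof -
  have fin: "finite (supp d)" and S: "supp d \<subseteq> S" and s1: "sum d (supp d) = 1"
    using assms(1) by (auto simp: dist_def)
  have "sum (push_dist f d) (supp (push_dist f d)) = sum (push_dist f d) (f ` supp d)"
    by (rule sum.mono_neutral_left) (use fin supp_push[of f d] in \<open>auto simp: supp_def\<close>)
  also have "\<dots> = 1"
    unfolding push_dist_def using sum.group[OF fin, of "f ` supp d" f d] fin s1 by auto
  finally have "sum (push_dist f d) (supp (push_dist f d)) = 1" .
  moreover have "finite (supp (push_dist f d))" using supp_push[of f d] fin by (meson finite_imageI finite_subset)
  moreover have "supp (push_dist f d) \<subseteq> T" using supp_push[of f d] S assms(2) by blast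
  ultimately show ?thesis by (simp add: dist_def)
qed

lemma push_dist_comp:
  assumes "finite (supp d)" shows "push_dist g (push_dist f d) = push_dist (\<lambda>s. g (f s)) d"
proof
  fix t
  let ?A = "{s\<in>supp d. g (f s) = t}"
  have "push_dist g (push_dist f d) t = sum (push_dist f d) {u \<in> f ` supp d. g u = t}"
    unfolding push_dist_def[of g] 
    by (rule sum.mono_neutral_left) (use assms supp_push[of f d] in \<open>auto simp: supp_def\<close>)
  also have "\<dots> = (\<Sum>u\<in>{u \<in> f ` supp d. g u = t}. sum d {s\<in>?A. f s = u})"
    unfolding push_dist_def by (intro sum.cong) (auto intro: sum.cong)
  also have "\<dots> = sum d ?A"
    by (rule sum.group) (use assms in auto)
  finally show "push_dist g (push_dist f d) t = push_dist (\<lambda>s. g (f s)) d t"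
    by (simp add: push_dist_def)
qed

lemma push_dist_cong: "(\<And>s. s \<in> supp d \<Longrightarrow> f s = g s) \<Longrightarrow> push_dist f d = push_dist g d"
  unfolding push_dist_def by (intro ext sum.cong) auto

lemma push_dist_id: "push_dist (\<lambda>s. s) d = d"
proof
  fix t
  have "{s \<in> supp d. s = t} = (if d t = 0 then {} else {t})" by (auto simp: supp_def)
  then show "push_dist (\<lambda>s. s) d t = d t" by (simp add: push_dist_def)
qed

lemma simplicial_set_dist_sset:
  assumes "simplicial_set Y" shows "simplicial_set (dist_sset Y)"
proof -
  interpret Y: simplicial_set Y by fact
  show ?thesis
  proof
    fix m k \<theta> z assume "\<theta> \<in> delta_hom m k" "z \<in> simp (dist_sset Y) k"
    then show "act (dist_sset Y) m k \<theta> z \<in> simp (dist_sset Y) m"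
      by (auto simp: dist_sset_def intro!: push_dist_in Y.act_closed)
  next
    fix m z assume "z \<in> simp (dist_sset Y) m"
    then show "act (dist_sset Y) m m (\<lambda>k\<in>{0..m}. k) z = z"
      using push_dist_cong[of z "act Y m m (\<lambda>k\<in>{0..m}. k)" "\<lambda>s. s"] Y.act_id
      by (auto simp: dist_sset_def push_dist_id dist_def)
  next
    fix k m l \<eta> \<theta> z assume *: "\<eta> \<in> delta_hom k m" "\<theta> \<in> delta_hom m l" "z \<in> simp (dist_sset Y) l"
    then show "act (dist_sset Y) k l (compose {0..k} \<theta> \<eta>) z
      = act (dist_sset Y) k m \<eta> (act (dist_sset Y) m l \<theta> z)"
      by (auto simp: dist_sset_def push_dist_comp dist_def intro!: push_dist_cong Y.act_comp)
  qed
qed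

lemma equiv_pushout_rel: "equiv UNIV (pushout_rel A f g n)"
  unfolding pushout_rel_def Let_def
  by (intro equivI refl_rtrancl trans_rtrancl sym_rtrancl) (auto simp: sym_def)

lemma pushout_rel_refl: "(u, u) \<in> pushout_rel A f g n"
  by (simp add: pushout_rel_def Let_def)

lemma pushout_rel_base: "a \<in> simp A n \<Longrightarrow> (Inl (f n a), Inr (g n a)) \<in> pushout_rel A f g n"
  unfolding pushout_rel_def Let_def by (intro r_into_rtrancl) auto

lemma pushout_rel_induct:
  assumes "(u,v) \<in> pushout_rel A f g n" 
    and "\<And>a. a \<in> simp A n \<Longrightarrow> F (Inl (f n a)) = F (Inr (g n a))"
  shows "F u = F v"
  using assms(1) unfolding pushout_rel_def Let_def
  by (induction rule: rtrancl_induct) (auto simp: assms(2))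

lemma pushout_class_eq: 
  "pushout_rel A f g n `` {u} = pushout_rel A f g n `` {v} \<longleftrightarrow> (u,v) \<in> pushout_rel A f g n"
  using equiv_pushout_rel by (metis UNIV_I eq_equiv_class_iff)

context
  fixes A B C f g
  assumes A: "simplicial_set A" and B: "simplicial_set B" and C: "simplicial_set C"
    and f: "f \<in> sMap A B" and g: "g \<in> sMap A C"
begin

lemma pushout_carrier:
  assumes "(u,v) \<in> pushout_rel A f g n" "u \<in> simp B n <+> simp C n"
  shows "v \<in> simp B n <+> simp C n"
proof -
  have "(u \<in> simp B n <+> simp C n) = (v \<in> simp B n <+> simp C n)"
    by (rule pushout_rel_induct[OF assms(1)]) (use f g in \<open>auto simp: sMap_def PiE_iff\<close>)
  with assms show ?thesis by simp
qed

lemma act_rel: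
  assumes "\<theta> \<in> delta_hom m n" "(u,v) \<in> pushout_rel A f g n"
  shows "(map_sum (act B m n \<theta>) (act C m n \<theta>) u, map_sum (act B m n \<theta>) (act C m n \<theta>) v) \<in> pushout_rel A f g m"
proof -
  let ?F = "\<lambda>u. pushout_rel A f g m `` {map_sum (act B m n \<theta>) (act C m n \<theta>) u}"
  have "?F u = ?F v"
  proof (rule pushout_rel_induct[OF assms(2)])
    fix a assume "a \<in> simp A n"
    with f g assms(1) have "act B m n \<theta> (f n a) = f m (act A m n \<theta> a)"
       "act C m n \<theta> (g n a) = g m (act A m n \<theta> a)" "act A m n \<theta> a \<in> simp A m"
      by (auto simp: sMap_def simplicial_set.act_closed[OF A])
    then show "?F (Inl (f n a)) = ?F (Inr (g n a))"
      by (simp add: pushout_class_eq pushout_rel_base)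
  qed
  then show ?thesis by (simp add: pushout_class_eq)
qed

lemma pushout_act:
  assumes "\<theta> \<in> delta_hom m n"
  shows "act (pushout A B C f g) m n \<theta> (pushout_rel A f g n `` {u})
       = pushout_rel A f g m `` {map_sum (act B m n \<theta>) (act C m n \<theta>) u}" (is "_ = ?R")
proof -
  have "u \<in> pushout_rel A f g n `` {u}" 
    by (simp add: pushout_rel_refl)
  moreover have "pushout_rel A f g m `` {map_sum (act B m n \<theta>) (act C m n \<theta>) v} = ?R"
     if "v \<in> pushout_rel A f g n `` {u}" for v
    using act_rel[OF assms] that equivE[OF equiv_pushout_rel, of A f g n] 
    by (metis Image_singleton_iff pushout_class_eq)
  ultimately have "(\<Union>v\<in>pushout_rel A f g n `` {u}.
      pushout_rel A f g m `` {map_sum (act B m n \<theta>) (act C m n \<theta>) v}) = ?R"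
    by blast
  moreover have "R `` (h ` c) = (\<Union>v\<in>c. R `` {h v})" for R :: "(('b+'c) \<times> ('b+'c)) set" and h :: "('b+'c) \<Rightarrow> ('b+'c)" and c
    by blast
  ultimately show ?thesis unfolding pushout_def by simp
qed

lemma simplicial_set_pushout: "simplicial_set (pushout A B C f g)"
proof
  interpret B: simplicial_set B by fact
  interpret C: simplicial_set C by fact
  have sP: "simp (pushout A B C f g) n = (simp B n <+> simp C n) // pushout_rel A f g n" for n
    by (simp add: pushout_def)
  have ex: "\<exists>u\<in>simp B n <+> simp C n. z = pushout_rel A f g n `` {u}"
     if "z \<in> simp (pushout A B C f g) n" for z n
    using that by (auto simp: pushout_def quotient_def)
  {
    fix m k \<theta> z assume *: "\<theta> \<in> delta_hom m k" "z \<in> simp (pushout A B C f g) k"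
    then show "act (pushout A B C f g) m k \<theta> z \<in> simp (pushout A B C f g) m"
      using ex[OF *(2)] by (auto simp: pushout_act[OF *(1)] sP intro!: quotientI B.act_closed[OF *(1)] C.act_closed[OF *(1)] InlI InrI)
  next
    fix m z assume "z \<in> simp (pushout A B C f g) m"
    then show "act (pushout A B C f g) m m (\<lambda>k\<in>{0..m}. k) z = z"
      using ex[of z m] by (auto simp: pushout_act[OF delta_hom_id] B.act_id C.act_id)
  next
    fix k m l \<eta> \<theta> z assume *: "\<eta> \<in> delta_hom k m" "\<theta> \<in> delta_hom m l" "z \<in> simp (pushout A B C f g) l"
    then show "act (pushout A B C f g) k l (compose {0..k} \<theta> \<eta>) z
      = act (pushout A B C f g) k m \<eta> (act (pushout A B C f g) m l \<theta> z)"
      using ex[OF *(3)] by (auto simp: pushout_act delta_hom_comp B.act_comp C.act_comp)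
  }
qed

lemma pushout_inl_sMap: "pushout_inl A B f g \<in> sMap B (pushout A B C f g)"
  using simplicial_set.act_closed[OF B] 
  by (auto simp: sMap_def pushout_inl_def pushout_act) (auto simp: pushout_def intro!: quotientI)

lemma pushout_inr_sMap: "pushout_inr A C f g \<in> sMap C (pushout A B C f g)"
  using simplicial_set.act_closed[OF C] 
  by (auto simp: sMap_def pushout_inr_def pushout_act) (auto simp: pushout_def intro!: quotientI)

lemma pushout_commutes:
  "sMap_comp A (pushout_inl A B f g) f = sMap_comp A (pushout_inr A C f g) g"
proof -
  have "f n a \<in> simp B n" "g n a \<in> simp C n" if "a \<in> simp A n" for n a
    using f g that by (auto simp: sMap_def PiE_iff)
  then show ?thesis
  by (auto simp: sMap_comp_def compose_def fun_eq_iff pushout_inl_def pushout_inr_def restrict_def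
     pushout_class_eq pushout_rel_base)
qed

lemma pushout_universal:
  assumes h: "h \<in> sMap B Z" and k: "k \<in> sMap C Z" and "sMap_comp A h f = sMap_comp A k g"
  shows "\<exists>!u. u \<in> sMap (pushout A B C f g) Z \<and> sMap_comp B u (pushout_inl A B f g) = h
    \<and> sMap_comp C u (pushout_inr A C f g) = k"
proof -
  let ?P = "pushout A B C f g"
  let ?c = "\<lambda>n u. pushout_rel A f g n `` {u}"
  define u0 where "u0 n c = (THE y. \<exists>v\<in>c. y = case_sum (h n) (k n) v)" for n c
  have eq: "case_sum (h n) (k n) a = case_sum (h n) (k n) b" if "(a,b) \<in> pushout_rel A f g n" for a b n
  proof (rule pushout_rel_induct[OF that])
    fix a assume "a \<in> simp A n"
    then show "case_sum (h n) (k n) (Inl (f n a)) = case_sum (h n) (k n) (Inr (g n a))"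
      using fun_cong[OF fun_cong[OF assms(3), of n], of a] by (auto simp: sMap_comp_def compose_def)
  qed
  have u0: "u0 n (?c n v) = case_sum (h n) (k n) v" for n v
    unfolding u0_def using eq equiv_pushout_rel[of A f g n]
    by (intro the_equality) (auto simp: dest: eq[symmetric] intro: pushout_rel_refl)
  have sP: "simp ?P n = ?c n ` (Inl ` simp B n \<union> Inr ` simp C n)" for n
    by (auto simp: pushout_def quotient_def Plus_def)
  define u where "u n = restrict (u0 n) (simp ?P n)" for n
  have uL: "u n (?c n (Inl b)) = h n b" if "b \<in> simp B n" for n b 
    using that by (auto simp: u_def sP u0)
  have uR: "u n (?c n (Inr b)) = k n b" if "b \<in> simp C n" for n b 
    using that by (auto simp: u_def sP u0)
  have hm: "h n b \<in> simp Z n" if "b \<in> simp B n" for n b using h that by (auto simp: sMap_def PiE_iff)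
  have km: "k n b \<in> simp Z n" if "b \<in> simp C n" for n b using k that by (auto simp: sMap_def PiE_iff)
  have usM: "u \<in> sMap ?P Z"
    unfolding sMap_def
  proof (intro CollectI conjI allI ballI)
    fix n show "u n \<in> simp ?P n \<rightarrow>\<^sub>E simp Z n"
      unfolding PiE_iff by (auto simp: sP uL uR hm km) (auto simp: u_def sP)
  next
    fix m n \<theta> z assume t: "\<theta> \<in> delta_hom m n" and z: "z \<in> simp ?P n"
    have "\<And>b. b \<in> simp B n \<Longrightarrow> h m (act B m n \<theta> b) = act Z m n \<theta> (h n b)"
      "\<And>b. b \<in> simp C n \<Longrightarrow> k m (act C m n \<theta> b) = act Z m n \<theta> (k n b)" 
      using h k t by (auto simp: sMap_def)
    then show "u m (act ?P m n \<theta> z) = act Z m n \<theta> (u n z)"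
      using z t by (auto simp: sP pushout_act uL uR simplicial_set.act_closed[OF B] simplicial_set.act_closed[OF C])
  qed
  have ext: "h n \<in> extensional (simp B n)" "k n \<in> extensional (simp C n)" for n
    using h k by (auto simp: sMap_def PiE_iff)
  have 1: "sMap_comp B u (pushout_inl A B f g) = h"
    using ext by (auto simp: sMap_comp_def compose_def pushout_inl_def fun_eq_iff uL restrict_def extensional_def)
  have 2: "sMap_comp C u (pushout_inr A C f g) = k"
    using ext by (auto simp: sMap_comp_def compose_def pushout_inr_def fun_eq_iff uR restrict_def extensional_def)
  show ?thesis
  proof (rule ex1I[of _ u])
    fix w assume w: "w \<in> sMap ?P Z \<and> sMap_comp B w (pushout_inl A B f g) = h
      \<and> sMap_comp C w (pushout_inr A C f g) = k"
    have "w n (?c n (Inl b)) = h n b" if "b \<in> simp B n" for n b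
      using w that by (auto simp: sMap_comp_def compose_def pushout_inl_def)
    moreover have "w n (?c n (Inr b)) = k n b" if "b \<in> simp C n" for n b
      using w that by (auto simp: sMap_comp_def compose_def pushout_inr_def)
    ultimately have *: "w n z = u n z" if "z \<in> simp ?P n" for n z
      using that by (auto simp: sP uL uR)
    have "w n \<in> extensional (simp ?P n)" "u n \<in> extensional (simp ?P n)" for n
      using w usM by (auto simp: sMap_def PiE_iff)
    then have "w n = u n" for n using * by (intro extensionalityI[of _ "simp ?P n"]) auto
    then show "w = u" by blast
  qed (use usM 1 2 in auto)
qed

end

lemma collapse_sanity:
  assumes "simplicial_set X" "x \<in> simp X n" "i < n"
  shows "simplicial_set (collapse X n i x)" "collapsing_map X n i x \<in> sMap X (collapse X n i x)"
proof -
  note * = simplicial_set_std_simplex[of n] simplicial_set_std_simplex[of "n - 1"] assms(1)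
    std_simplex_map_sMap[OF codegen_hom[OF assms(3)]] yoneda_sMap[OF assms(1,2)]
  show "simplicial_set (collapse X n i x)" "collapsing_map X n i x \<in> sMap X (collapse X n i x)"
    unfolding collapse_def collapsing_map_def
    using simplicial_set_pushout[OF *] pushout_inr_sMap[OF *] by blast+
qed

end

theory Submission
  imports Defs
begin

text \<open>
  The collapsing map \<open>\<pi>\<close> is surjective in each degree, so \<open>\<pi>\<^sup>*\<close> is injective, and a simplicial map
  \<open>f : X \<rightarrow> Z\<close> factors through \<open>\<pi>\<close> exactly when \<open>f x\<close> lies in the image of the degeneracy \<open>s\<^sub>i\<close> of \<open>Z\<close>.
  Since \<open>\<pi> x\<close> is such a degeneracy, \<open>p (\<pi> x)\<close> is supported on the image of \<open>s\<^sub>i\<close>. Zero-sum-freeness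
  forces every map contributing to a decomposition of \<open>\<pi>\<^sup>* p\<close> to send \<open>x\<close> into that image (into
  distributions supported on it, when \<open>R\<close> is integral), so all such decompositions come
  from decompositions of \<open>p\<close>.
\<close>

section \<open>Distributions and semirings\<close>

text \<open>Splitting off one summand reduces this to the two-term definition; it plays the part
  that nonnegativity plays over the reals.\<close>

lemma sum_eq_0_zero_sum_free:
  fixes f :: "'s \<Rightarrow> 'r::comm_semiring_1"
  assumes "zero_sum_free TYPE('r)" "finite A" "sum f A = 0" "a \<in> A"
  shows "f a = 0"
proof -
  have "f a + sum f (A - {a}) = 0"
    using assms(2,3,4) by (simp add: sum.remove[symmetric])
  then show ?thesis
    using assms(1) unfolding zero_sum_free_def by blast
qed

lemma sum_supp_push_dist:
  assumes "finite (supp d)"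
  shows "(\<Sum>t\<in>supp (push_dist f d). push_dist f d t * g t) = (\<Sum>s\<in>supp d. d s * g (f s))"
proof -
  have "(\<Sum>t\<in>supp (push_dist f d). push_dist f d t * g t) = (\<Sum>t\<in>f ` supp d. push_dist f d t * g t)"
    \<comment> \<open>Weights in a fibre may add up to 0, so the support of the pushforward can be
      smaller than the image; the added terms vanish.\<close>
    by (rule sum.mono_neutral_left) (use assms supp_push[of f d] in \<open>auto simp: supp_def\<close>)
  also have "\<dots> = (\<Sum>t\<in>f ` supp d. \<Sum>s\<in>{s \<in> supp d. f s = t}. d s * g (f s))"
    by (simp add: push_dist_def sum_distrib_right)
  also have "\<dots> = (\<Sum>s\<in>supp d. d s * g (f s))"
    using assms by (intro sum.group) auto
  finally show ?thesis .
qed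

lemma push_dist_inverse:
  assumes "finite (supp d)" "\<And>s. s \<in> supp d \<Longrightarrow> g (f s) = s"
  shows "push_dist g (push_dist f d) = d"
proof -
  have "push_dist g (push_dist f d) = push_dist (\<lambda>s. g (f s)) d"
    using push_dist_comp[OF assms(1), of g f] by (simp add: comp_def)
  also have "\<dots> = push_dist (\<lambda>s. s) d"
    by (rule push_dist_cong) (rule assms(2))
  finally show ?thesis
    by (simp add: push_dist_id)
qed

text \<open>A section of \<open>f\<close> over its image carries \<open>d\<close> back to
  \<open>A\<close>. This is how decompositions are lifted once their support is known to lie in an
  image.\<close>

lemma push_dist_preimage:
  assumes "d \<in> dist S" "supp d \<subseteq> f ` A"
  obtains d' where "d' \<in> dist A" "push_dist f d' = d"
proof
  have "d \<in> dist (f ` A)"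
    using assms by (auto simp: dist_def)
  then show "push_dist (inv_into A f) d \<in> dist A"
    by (rule push_dist_in) (rule inv_into_into)
  show "push_dist f (push_dist (inv_into A f) d) = d"
    using assms by (intro push_dist_inverse) (auto simp: dist_def f_inv_into_f)
qed

lemma inj_on_push_dist:
  assumes "inj_on f A"
  shows "inj_on (push_dist f) (dist A)"
proof (rule inj_on_inverseI)
  fix d assume "d \<in> dist A"
  then show "push_dist (inv_into A f) (push_dist f d) = d"
    using assms by (intro push_dist_inverse) (auto simp: dist_def subset_iff)
qed

text \<open>Each marginal is the pushforward along evaluation at \<open>z\<close>, so
  \<open>push_dist_comp\<close> can handle changes of the space of maps.\<close>

lemma noncontextual_iff_push_dist:
  "noncontextual X Y p \<longleftrightarrow> (\<exists>d\<in>dist (sMap X Y). \<forall>n. \<forall>z\<in>simp X n. \<forall>y\<in>simp Y n.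
     p n z y = push_dist (\<lambda>\<phi>. \<phi> n z) d y)"
  by (simp add: noncontextual_def push_dist_def)

section \<open>The coface splitting a codegeneracy\<close>

text \<open>The injection usually written \<open>d^(i+1)\<close>, which skips \<open>i + 1\<close>;
  it serves as a section of \<open>codegen n i\<close>.\<close>

definition coface :: "nat \<Rightarrow> nat \<Rightarrow> (nat \<Rightarrow> nat)" where
  "coface n i = (\<lambda>k\<in>{0..n - 1}. if k \<le> i then k else k + 1)"

lemma coface_hom: "i < n \<Longrightarrow> coface n i \<in> delta_hom (n - 1) n"
  unfolding coface_def delta_hom_def mono_on_def by auto

lemma codegen_coface:
  "i < n \<Longrightarrow> compose {0..n - 1} (codegen n i) (coface n i) = (\<lambda>k\<in>{0..n - 1}. k)"
  by (auto simp: codegen_def coface_def compose_def fun_eq_iff)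

lemma compose_delta_hom_id:
  assumes "\<theta> \<in> delta_hom m n"
  shows "compose {0..m} (\<lambda>k\<in>{0..n}. k) \<theta> = \<theta>"
  using assms by (auto simp: delta_hom_def compose_def fun_eq_iff PiE_iff extensional_def)

lemma compose_id_delta_hom:
  assumes "\<theta> \<in> delta_hom m n"
  shows "compose {0..m} \<theta> (\<lambda>k\<in>{0..m}. k) = \<theta>"
  using assms by (auto simp: delta_hom_def compose_def fun_eq_iff PiE_iff extensional_def)

text \<open>Reassociating leaves the section identity. Thus the map from \<Delta>[n] to
  \<Delta>[n-1] induced by \<open>codegen n i\<close> is surjective in each degree.\<close>

lemma codegen_coface_compose:
  assumes "i < n" "\<theta> \<in> delta_hom m (n - 1)"
  shows "compose {0..m} (codegen n i) (compose {0..m} (coface n i) \<theta>) = \<theta>"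
proof -
  have "compose {0..m} (codegen n i) (compose {0..m} (coface n i) \<theta>)
      = compose {0..m} (compose {0..n - 1} (codegen n i) (coface n i)) \<theta>"
    using delta_hom_le[OF assms(2)] by (auto simp: compose_def fun_eq_iff)
  then show ?thesis
    using assms by (simp add: codegen_coface compose_delta_hom_id del: One_nat_def)
qed

section \<open>Factoring maps through the collapsing map\<close>

lemma sMap_extensional: "f \<in> sMap X Z \<Longrightarrow> f m \<in> extensional (simp X m)"
  by (simp add: sMap_def PiE_iff)

lemma sMap_comp_apply: "z \<in> simp X n \<Longrightarrow> sMap_comp X g f n z = g n (f n z)"
  by (simp add: sMap_comp_def compose_def)

lemma sMap_comp_in:
  assumes "simplicial_set X" "f \<in> sMap X Y" "g \<in> sMap Y Z"
  shows "sMap_comp X g f \<in> sMap X Z"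
  using assms simplicial_set.act_closed[OF assms(1)]
  by (auto simp: sMap_def sMap_comp_def compose_def PiE_iff extensional_def)

locale collapsing = simplicial_set X for X :: "'a sset" +
  fixes n i :: nat and x :: 'a
  assumes x: "x \<in> simp X n" and i: "i < n"
begin

abbreviation "Xc \<equiv> collapse X n i x"
abbreviation "\<pi> \<equiv> collapsing_map X n i x"
abbreviation "pull f \<equiv> sMap_comp X f \<pi>"
abbreviation "degen Z \<equiv> act Z n (n - 1) (codegen n i)"

lemma pushout_facts:
  "simplicial_set (std_simplex n)" "simplicial_set (std_simplex (n - 1))" "simplicial_set X"
  "std_simplex_map n (codegen n i) \<in> sMap (std_simplex n) (std_simplex (n - 1))"
  "yoneda X n x \<in> sMap (std_simplex n) X"
  by (intro simplicial_set_std_simplex simplicial_set_axioms std_simplex_map_sMap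
      codegen_hom i yoneda_sMap x)+

lemma \<pi>_sMap: "\<pi> \<in> sMap X Xc"
  by (rule collapse_sanity(2)[OF simplicial_set_axioms x i])

lemma \<pi>_in: "z \<in> simp X m \<Longrightarrow> \<pi> m z \<in> simp Xc m"
  using \<pi>_sMap by (auto simp: sMap_def)

lemma pull_in: "f \<in> sMap Xc Z \<Longrightarrow> pull f \<in> sMap X Z"
  by (rule sMap_comp_in[OF simplicial_set_axioms \<pi>_sMap])

text \<open>Lift \<open>\<theta>\<close> along the coface to a simplex of \<Delta>[n] and evaluate
  the commuting pushout square there. Hence the summand \<Delta>[n-1] adds no simplices beyond the
  image of \<open>\<pi>\<close>.\<close>

lemma inl_eq_\<pi>:
  assumes "\<theta> \<in> delta_hom m (n - 1)"
  shows "pushout_inl (std_simplex n) (std_simplex (n - 1)) (std_simplex_map n (codegen n i))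
           (yoneda X n x) m \<theta> = \<pi> m (act X m n (compose {0..m} (coface n i) \<theta>) x)"
proof -
  let ?\<eta> = "compose {0..m} (coface n i) \<theta>"
  have \<eta>: "?\<eta> \<in> delta_hom m n"
    using assms coface_hom[OF i] by (rule delta_hom_comp)
  have 1: "std_simplex_map n (codegen n i) m ?\<eta> = \<theta>"
    using \<eta> by (simp add: std_simplex_map_def codegen_coface_compose[OF i assms])
  show ?thesis
    using fun_cong[OF fun_cong[OF pushout_commutes[OF pushout_facts], of m], of ?\<eta>] \<eta>
    by (simp add: sMap_comp_def compose_def[of "delta_hom m n"] std_simplex_def 1 collapsing_map_def)
       (simp add: yoneda_def)
qed

lemma \<pi>_surj:
  assumes "c \<in> simp Xc m"
  obtains z where "z \<in> simp X m" "c = \<pi> m z"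
proof -
  consider \<theta> where "\<theta> \<in> delta_hom m (n - 1)"
      "c = pushout_inl (std_simplex n) (std_simplex (n - 1)) (std_simplex_map n (codegen n i))
           (yoneda X n x) m \<theta>"
    | z where "z \<in> simp X m" "c = \<pi> m z"
    using assms unfolding collapse_def collapsing_map_def
    by (auto simp: pushout_def quotient_def pushout_inl_def pushout_inr_def std_simplex_def)
  then show thesis
  proof cases
    case 1
    then show ?thesis
      using that inl_eq_\<pi> act_closed[OF delta_hom_comp[OF _ coface_hom[OF i]] x] by metis
  next
    case 2
    then show ?thesis by (rule that)
  qed
qed

text \<open>The witness is the image of the identity simplex of \<Delta>[n-1]. The pushout square at
  the identity of [n], which \<open>yoneda\<close> sends to \<open>x\<close>, gives the
  equation.\<close>

lemma \<pi>_x: obtains w where "w \<in> simp Xc (n - 1)" "\<pi> n x = degen Xc w"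
proof
  let ?inl = "pushout_inl (std_simplex n) (std_simplex (n - 1)) (std_simplex_map n (codegen n i))
           (yoneda X n x)"
  let ?id = "\<lambda>k\<in>{0..n - 1}. k"
  have inl: "?inl \<in> sMap (std_simplex (n - 1)) Xc"
    unfolding collapse_def by (rule pushout_inl_sMap[OF pushout_facts])
  have id: "?id \<in> simp (std_simplex (n - 1)) (n - 1)"
    by (simp add: std_simplex_def delta_hom_id)
  show "?inl (n - 1) ?id \<in> simp Xc (n - 1)"
    using inl id by (auto simp: sMap_def)
  have "degen Xc (?inl (n - 1) ?id) = ?inl n (compose {0..n} ?id (codegen n i))"
    using inl id codegen_hom[OF i] by (auto simp: sMap_def std_simplex_def)
  also have "\<dots> = ?inl n (std_simplex_map n (codegen n i) n (\<lambda>k\<in>{0..n}. k))"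
    using codegen_hom[OF i] delta_hom_id[of n]
    by (simp add: compose_delta_hom_id compose_id_delta_hom std_simplex_map_def)
  also have "\<dots> = \<pi> n (yoneda X n x n (\<lambda>k\<in>{0..n}. k))"
    using fun_cong[OF fun_cong[OF pushout_commutes[OF pushout_facts], of n], of "\<lambda>k\<in>{0..n}. k"]
      delta_hom_id[of n]
    by (simp add: sMap_comp_def compose_def[of "delta_hom n n"] std_simplex_def collapsing_map_def)
  finally show "\<pi> n x = degen Xc (?inl (n - 1) ?id)"
    by (simp add: yoneda_def delta_hom_id act_id x)
qed

lemma pull_x:
  assumes "f \<in> sMap Xc Z"
  obtains w where "w \<in> simp Z (n - 1)" "f n (\<pi> n x) = degen Z w"
proof -
  obtain w where w: "w \<in> simp Xc (n - 1)" "\<pi> n x = degen Xc w"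
    by (rule \<pi>_x)
  have "f (n - 1) w \<in> simp Z (n - 1)" "f n (\<pi> n x) = degen Z (f (n - 1) w)"
    using assms w codegen_hom[OF i] by (auto simp: sMap_def)
  then show thesis by (rule that)
qed

text \<open>Surjectivity of \<open>\<pi>\<close> fixes the values on simplices. Only extensionality
  is assumed, so the lemma applies directly to \<open>delta_map\<close> and \<open>mixture\<close>,
  without checking that they are simplicial.\<close>

lemma pull_eqD:
  assumes ext: "\<And>m. f m \<in> extensional (simp Xc m)" "\<And>m. g m \<in> extensional (simp Xc m)"
    and eq: "pull f = pull g"
  shows "f = g"
proof
  fix m
  have "f m c = g m c" if c: "c \<in> simp Xc m" for c
  proof -
    obtain z where "z \<in> simp X m" "c = \<pi> m z"
      using \<pi>_surj[OF c] by blast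
    then show ?thesis
      using eq by (metis sMap_comp_apply)
  qed
  with ext show "f m = g m"
    by (rule extensionalityI)
qed

lemma inj_on_pull: "inj_on pull (sMap Xc Z)"
  by (intro inj_onI pull_eqD sMap_extensional)

text \<open>By Yoneda, \<open>w\<close> is a map from \<Delta>[n-1] to \<open>Z\<close>; the
  equation for \<open>f n x\<close> makes it and \<open>f\<close> a cocone on the pushout diagram,
  and the universal property gives the factor.\<close>

lemma factors_through_\<pi>:
  assumes Z: "simplicial_set Z" and f: "f \<in> sMap X Z"
    and w: "w \<in> simp Z (n - 1)" "f n x = degen Z w"
  shows "f \<in> pull ` sMap Xc Z"
proof -
  interpret Z: simplicial_set Z by fact
  have "sMap_comp (std_simplex n) (yoneda Z (n - 1) w) (std_simplex_map n (codegen n i))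
      = sMap_comp (std_simplex n) f (yoneda X n x)"
  proof (intro ext)
    fix m \<theta>
    show "sMap_comp (std_simplex n) (yoneda Z (n - 1) w) (std_simplex_map n (codegen n i)) m \<theta>
      = sMap_comp (std_simplex n) f (yoneda X n x) m \<theta>"
    proof (cases "\<theta> \<in> delta_hom m n")
      case True
      have "act Z m (n - 1) (compose {0..m} (codegen n i) \<theta>) w = act Z m n \<theta> (f n x)"
        using Z.act_comp[OF True codegen_hom[OF i] w(1)] w(2) by simp
      also have "\<dots> = f m (act X m n \<theta> x)"
        using f True x by (auto simp: sMap_def)
      finally show ?thesis
        using True delta_hom_comp[OF True codegen_hom[OF i]]
        by (simp add: sMap_comp_def compose_def[of "delta_hom m n"] std_simplex_def
            std_simplex_map_def yoneda_def)
    qed (simp add: sMap_comp_def compose_def std_simplex_def)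
  qed
  from pushout_universal[OF pushout_facts yoneda_sMap[OF Z w(1)] f this]
  show ?thesis
    unfolding collapse_def collapsing_map_def by blast
qed

lemma pull_delta_map: "pull (delta_map Xc \<psi>) = delta_map X (pull \<psi>)"
  using \<pi>_in by (auto simp: sMap_comp_def compose_def delta_map_def fun_eq_iff)

text \<open>Naturality of \<nu>: a change of variables in the sum over \<open>q\<close>, with each
  evaluation at \<open>z\<close> becoming one at \<open>\<pi> m z\<close>.\<close>

lemma mixture_push_pull:
  assumes "finite (supp Q)"
  shows "mixture X (push_dist pull Q) = pull (mixture Xc Q)"
proof (intro ext)
  fix m z y
  show "mixture X (push_dist pull Q) m z y = pull (mixture Xc Q) m z y"
  proof (cases "z \<in> simp X m")
    case True
    then have "mixture X (push_dist pull Q) m z y = (\<Sum>q\<in>supp Q. Q q * pull q m z y)"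
      by (simp add: mixture_def sum_supp_push_dist[OF assms, where g = "\<lambda>q. q m z y"])
    with True show ?thesis
      by (simp add: sMap_comp_apply mixture_def \<pi>_in)
  qed (simp add: mixture_def sMap_comp_def compose_def)
qed

end

section \<open>Distributions pulled back along the collapsing map\<close>

locale collapsing_dist = collapsing X n i x for X :: "'a sset" and n i x +
  fixes Y :: "'b sset"
    and p :: "nat \<Rightarrow> ((nat \<Rightarrow> nat) + 'a) set \<Rightarrow> ('b \<Rightarrow> 'r::comm_semiring_1)"
  assumes Y: "simplicial_set Y"
    and p: "p \<in> simplicial_distributions Xc Y"
begin

section \<open>Descent of maps whose value at \<open>x\<close> is supported by
  \<open>p\<close>\<close>

lemma supp_p_\<pi>_x: "supp (p n (\<pi> n x)) \<subseteq> degen Y ` simp Y (n - 1)"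
proof -
  obtain w where "w \<in> dist (simp Y (n - 1))" "p n (\<pi> n x) = push_dist (degen Y) w"
    using pull_x[OF p] by (auto simp: dist_sset_def)
  then show ?thesis
    using supp_push[of "degen Y" w] by (auto simp: dist_def)
qed

lemma supported_factors:
  assumes "\<phi> \<in> sMap X Y" "pull p n x (\<phi> n x) \<noteq> 0"
  shows "\<phi> \<in> pull ` sMap Xc Y"
proof -
  have "\<phi> n x \<in> supp (p n (\<pi> n x))"
    using assms(2) by (simp add: supp_def sMap_comp_apply x)
  then obtain w where "w \<in> simp Y (n - 1)" "\<phi> n x = degen Y w"
    using supp_p_\<pi>_x by blast
  then show ?thesis
    by (rule factors_through_\<pi>[OF Y assms(1)])
qed

text \<open>Here the factorization criterion is used with target D_R(Y): a distribution supported on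
  degenerate simplices is itself the degeneracy of a distribution on
  \<open>simp Y (n - 1)\<close>.\<close>

lemma dist_supported_factors:
  fixes q :: "nat \<Rightarrow> 'a \<Rightarrow> ('b \<Rightarrow> 'r)"
  assumes q: "q \<in> simplicial_distributions X Y" and "supp (q n x) \<subseteq> supp (p n (\<pi> n x))"
  shows "q \<in> pull ` simplicial_distributions Xc Y"
proof -
  have "q n x \<in> dist (simp Y n)"
    using q x by (auto simp: sMap_def dist_sset_def)
  moreover have "supp (q n x) \<subseteq> degen Y ` simp Y (n - 1)"
    using assms(2) supp_p_\<pi>_x by (rule subset_trans)
  ultimately obtain w where "w \<in> dist (simp Y (n - 1))" "push_dist (degen Y) w = q n x"
    by (rule push_dist_preimage)
  then show ?thesis
    using factors_through_\<pi>[OF simplicial_set_dist_sset[OF Y] q, of w]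
    by (simp add: dist_sset_def)
qed

section \<open>Contextuality\<close>

lemma noncontextual_pull:
  assumes "noncontextual Xc Y p"
  shows "noncontextual X Y (pull p)"
proof -
  obtain d where d: "d \<in> dist (sMap Xc Y)"
    and pd: "\<And>m c y. c \<in> simp Xc m \<Longrightarrow> y \<in> simp Y m \<Longrightarrow> p m c y = push_dist (\<lambda>\<psi>. \<psi> m c) d y"
    using assms by (auto simp: noncontextual_iff_push_dist)
  have "push_dist (\<lambda>\<phi>. \<phi> m z) (push_dist pull d) = push_dist (\<lambda>\<psi>. \<psi> m (\<pi> m z)) d"
    if "z \<in> simp X m" for m z
    using d that by (simp add: dist_def push_dist_comp sMap_comp_apply)
  moreover have "push_dist pull d \<in> dist (sMap X Y)"
    using d pull_in by (rule push_dist_in)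
  ultimately show ?thesis
    unfolding noncontextual_iff_push_dist
    by (intro bexI[of _ "push_dist pull d"]) (simp_all add: sMap_comp_apply pd \<pi>_in)
qed

lemma noncontextual_pullD:
  assumes zsf: "zero_sum_free TYPE('r)" and "noncontextual X Y (pull p)"
  shows "noncontextual Xc Y p"
proof -
  obtain d where d: "d \<in> dist (sMap X Y)"
    and pd: "\<And>m z y. z \<in> simp X m \<Longrightarrow> y \<in> simp Y m \<Longrightarrow> pull p m z y = push_dist (\<lambda>\<phi>. \<phi> m z) d y"
    using assms(2) by (auto simp: noncontextual_iff_push_dist)
  have "supp d \<subseteq> pull ` sMap Xc Y"
  proof
    fix \<phi> assume \<phi>: "\<phi> \<in> supp d"
    then have \<phi>_sMap: "\<phi> \<in> sMap X Y"
      using d by (auto simp: dist_def)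
    \<comment> \<open>Otherwise the weights of all maps agreeing with \<open>\<phi>\<close> at
      \<open>x\<close> would sum to 0, and zero-sum-freeness would force
      \<open>d \<phi> = 0\<close>.\<close>
    have "pull p n x (\<phi> n x) \<noteq> 0"
    proof
      assume "pull p n x (\<phi> n x) = 0"
      moreover have "\<phi> n x \<in> simp Y n"
        using \<phi>_sMap x by (auto simp: sMap_def)
      ultimately have "(\<Sum>\<phi>'\<in>{\<phi>' \<in> supp d. \<phi>' n x = \<phi> n x}. d \<phi>') = 0"
        using pd[OF x] by (simp add: push_dist_def)
      then have "d \<phi> = 0"
        using d \<phi>
        by (intro sum_eq_0_zero_sum_free[OF zsf, of "{\<phi>' \<in> supp d. \<phi>' n x = \<phi> n x}" d])
           (auto simp: dist_def)
      with \<phi> show False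
        by (simp add: supp_def)
    qed
    with \<phi>_sMap show "\<phi> \<in> pull ` sMap Xc Y"
      by (rule supported_factors)
  qed
  then obtain d' where d': "d' \<in> dist (sMap Xc Y)" "push_dist pull d' = d"
    using push_dist_preimage[OF d] by blast
  have "p m c y = push_dist (\<lambda>\<psi>. \<psi> m c) d' y" if c: "c \<in> simp Xc m" and "y \<in> simp Y m" for m c y
  proof -
    obtain z where z: "z \<in> simp X m" "c = \<pi> m z"
      using \<pi>_surj[OF c] by blast
    have "push_dist (\<lambda>\<phi>. \<phi> m z) d = push_dist (\<lambda>\<psi>. \<psi> m c) d'"
      using d' z by (auto simp: dist_def push_dist_comp sMap_comp_apply)
    with pd[OF z(1) \<open>y \<in> simp Y m\<close>] z show ?thesis
      by (simp add: sMap_comp_apply)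
  qed
  with d'(1) show ?thesis
    by (auto simp: noncontextual_iff_push_dist)
qed

section \<open>Strong contextuality and determinism\<close>

lemma strongly_contextual_pull: "strongly_contextual X Y (pull p) \<longleftrightarrow> strongly_contextual Xc Y p"
proof -
  have "(\<exists>\<phi>\<in>sMap X Y. \<forall>m. \<forall>z\<in>simp X m. pull p m z (\<phi> m z) \<noteq> 0) \<longleftrightarrow>
    (\<exists>\<psi>\<in>sMap Xc Y. \<forall>m. \<forall>c\<in>simp Xc m. p m c (\<psi> m c) \<noteq> 0)"
  proof
    assume "\<exists>\<phi>\<in>sMap X Y. \<forall>m. \<forall>z\<in>simp X m. pull p m z (\<phi> m z) \<noteq> 0"
    then obtain \<psi> where \<psi>: "\<psi> \<in> sMap Xc Y"
      and nz: "\<And>m z. z \<in> simp X m \<Longrightarrow> pull p m z (pull \<psi> m z) \<noteq> 0"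
      \<comment> \<open>Nonvanishing at the single simplex \<open>x\<close> already makes
        \<open>\<phi>\<close> descend.\<close>
      using supported_factors x by blast
    have "p m c (\<psi> m c) \<noteq> 0" if "c \<in> simp Xc m" for m c
      using \<pi>_surj[OF that] nz by (metis sMap_comp_apply)
    with \<psi> show "\<exists>\<psi>\<in>sMap Xc Y. \<forall>m. \<forall>c\<in>simp Xc m. p m c (\<psi> m c) \<noteq> 0"
      by blast
  next
    assume "\<exists>\<psi>\<in>sMap Xc Y. \<forall>m. \<forall>c\<in>simp Xc m. p m c (\<psi> m c) \<noteq> 0"
    then obtain \<psi> where "\<psi> \<in> sMap Xc Y" "\<forall>m. \<forall>c\<in>simp Xc m. p m c (\<psi> m c) \<noteq> 0"
      by blast
    then show "\<exists>\<phi>\<in>sMap X Y. \<forall>m. \<forall>z\<in>simp X m. pull p m z (\<phi> m z) \<noteq> 0"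
      by (intro bexI[of _ "pull \<psi>"]) (simp_all add: sMap_comp_apply \<pi>_in pull_in)
  qed
  then show ?thesis
    by (simp add: strongly_contextual_def)
qed

lemma deterministic_pull: "deterministic X Y (pull p) \<longleftrightarrow> deterministic Xc Y p"
proof
  assume "deterministic X Y (pull p)"
  then obtain \<phi> where \<phi>: "\<phi> \<in> sMap X Y" "pull p = delta_map X \<phi>"
    by (auto simp: deterministic_def)
  \<comment> \<open>The value is 1, which differs from 0, so \<open>\<phi>\<close> descends as
    well.\<close>
  then have "pull p n x (\<phi> n x) \<noteq> 0"
    using x by (simp add: delta_map_def delta_dist_def)
  then obtain \<psi> where \<psi>: "\<psi> \<in> sMap Xc Y" "\<phi> = pull \<psi>"
    using supported_factors \<phi>(1) by blast
  have "p = delta_map Xc \<psi>"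
  proof (rule pull_eqD)
    show "pull p = pull (delta_map Xc \<psi>)"
      by (simp add: pull_delta_map \<phi>(2) \<psi>(2))
  qed (use p in \<open>simp_all add: sMap_extensional delta_map_def\<close>)
  with \<psi>(1) show "deterministic Xc Y p"
    by (auto simp: deterministic_def)
next
  assume "deterministic Xc Y p"
  then show "deterministic X Y (pull p)"
    by (auto simp: deterministic_def pull_delta_map intro: pull_in)
qed

section \<open>Vertices\<close>

text \<open>Where \<open>p n (\<pi> n x)\<close> vanishes, zero-sum-freeness kills every product
  \<open>Q q * q n x y\<close>; integrality and \<open>Q q \<noteq> 0\<close> then give
  \<open>q n x y = 0\<close>. So no \<open>q\<close> in the mixture enlarges the support at
  \<open>x\<close>.\<close>

lemma mixture_supp_factors:
  fixes Q :: "(nat \<Rightarrow> 'a \<Rightarrow> ('b \<Rightarrow> 'r)) \<Rightarrow> 'r"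
  assumes zsf: "zero_sum_free TYPE('r)" and int: "integral_semiring TYPE('r)"
    and Q: "Q \<in> dist (simplicial_distributions X Y)" "mixture X Q = pull p"
  shows "supp Q \<subseteq> pull ` simplicial_distributions Xc Y"
proof
  fix q assume q: "q \<in> supp Q"
  have "supp (q n x) \<subseteq> supp (p n (\<pi> n x))"
  proof
    fix y assume y: "y \<in> supp (q n x)"
    show "y \<in> supp (p n (\<pi> n x))"
    proof (rule ccontr)
      assume "y \<notin> supp (p n (\<pi> n x))"
      then have "mixture X Q n x y = 0"
        by (simp add: Q(2) sMap_comp_apply x supp_def)
      then have "(\<Sum>q\<in>supp Q. Q q * q n x y) = 0"
        by (simp add: mixture_def x)
      then have "Q q * q n x y = 0"
        using Q(1) q
        by (intro sum_eq_0_zero_sum_free[OF zsf, of "supp Q" "\<lambda>q. Q q * q n x y"])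
           (auto simp: dist_def)
      then show False
        using int q y unfolding integral_semiring_def supp_def by blast
    qed
  qed
  moreover have "q \<in> simplicial_distributions X Y"
    using Q(1) q by (auto simp: dist_def)
  ultimately show "q \<in> pull ` simplicial_distributions Xc Y"
    by (intro dist_supported_factors)
qed

text \<open>Pushing forward along \<open>pull\<close> is a bijection between the \<nu>-preimages of
  \<open>p\<close> and those of \<open>pull p\<close>, so one set is a singleton exactly when the
  other is.\<close>

lemma vertex_pull:
  assumes "zero_sum_free TYPE('r)" "integral_semiring TYPE('r)"
  shows "vertex X Y (pull p) \<longleftrightarrow> vertex Xc Y p"
proof -
  let ?A = "{Q \<in> dist (simplicial_distributions Xc Y). mixture Xc Q = p}"
  let ?B = "{Q \<in> dist (simplicial_distributions X Y). mixture X Q = pull p}"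
  have "bij_betw (push_dist pull) ?A ?B"
    unfolding bij_betw_def
  proof
    show "inj_on (push_dist pull) ?A"
      using inj_on_push_dist[OF inj_on_pull] by (rule inj_on_subset) auto
    show "push_dist pull ` ?A = ?B"
    proof (intro equalityI subsetI)
      fix Q assume "Q \<in> push_dist pull ` ?A"
      then show "Q \<in> ?B"
        by (auto simp: dist_def[of "sMap Xc _"] mixture_push_pull
            intro!: push_dist_in[of _ "simplicial_distributions Xc Y"] pull_in)
    next
      fix Q assume "Q \<in> ?B"
      then have Q: "Q \<in> dist (simplicial_distributions X Y)" "mixture X Q = pull p"
        by auto
      obtain Q' where Q': "Q' \<in> dist (simplicial_distributions Xc Y)" "push_dist pull Q' = Q"
        using push_dist_preimage[OF Q(1) mixture_supp_factors[OF assms Q]] .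
      have "mixture Xc Q' = p"
      proof (rule pull_eqD)
        show "pull (mixture Xc Q') = pull p"
          using Q Q' mixture_push_pull[of Q'] by (simp add: dist_def)
      qed (use p in \<open>simp_all add: sMap_extensional mixture_def\<close>)
      with Q' show "Q \<in> push_dist pull ` ?A"
        by blast
    qed
  qed
  then have "is_singleton ?A \<longleftrightarrow> is_singleton ?B"
    by (simp add: is_singleton_altdef bij_betw_same_card)
  then show ?thesis
    by (simp add: vertex_def is_singleton_iff_ex1)
qed

end

theorem theorem4p4:
  fixes X :: "'a sset" and Y :: "'b sset" and n i :: nat and x :: 'a
    and p :: "nat \<Rightarrow> ((nat \<Rightarrow> nat) + 'a) set \<Rightarrow> ('b \<Rightarrow> 'r::comm_semiring_1)"
  assumes "zero_sum_free TYPE('r)"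
    and "simplicial_set X" and "simplicial_set Y"
    and "finite (nondegenerate_simplices X)"
    and "n \<ge> 1" and "x \<in> simp X n" and "i \<le> n - 1"
    and "p \<in> simplicial_distributions (collapse X n i x) Y"
  shows
    "(contextual (collapse X n i x) Y p \<longleftrightarrow> contextual X Y (pullback_dist X n i x p)) \<and>
     (strongly_contextual (collapse X n i x) Y p \<longleftrightarrow>
        strongly_contextual X Y (pullback_dist X n i x p)) \<and>
     (integral_semiring TYPE('r) \<longrightarrow>
        (vertex (collapse X n i x) Y p \<longleftrightarrow> vertex X Y (pullback_dist X n i x p))) \<and>
     (deterministic (collapse X n i x) Y p \<longleftrightarrow> deterministic X Y (pullback_dist X n i x p)) \<and>
     (integral_semiring TYPE('r) \<longrightarrow>
        (contextual (collapse X n i x) Y p \<and> vertex (collapse X n i x) Y p \<longleftrightarrow>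
         contextual X Y (pullback_dist X n i x p) \<and> vertex X Y (pullback_dist X n i x p)))"
proof -
  \<comment> \<open>The bounds \<open>n \<ge> 1\<close> and \<open>i \<le> n - 1\<close> together
    yield the \<open>i < n\<close> required by the locale; truncated subtraction makes the first one
    necessary for this.\<close>
  interpret collapsing_dist X n i x Y p
    using assms by (auto simp: collapsing_dist_def collapsing_def collapsing_axioms_def
        collapsing_dist_axioms_def)
  have "contextual Xc Y p \<longleftrightarrow> contextual X Y (pull p)"
    using noncontextual_pull noncontextual_pullD[OF assms(1)] by blast
  then show ?thesis
    unfolding pullback_dist_def
    using strongly_contextual_pull deterministic_pull vertex_pull[OF assms(1)] by blast
qed

end
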